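(* Let $p\ge 7$ be a prime number with $p\equiv 1\pmod 4$. Then $\mathcal{T}_1(\mathrm{Paley}(p))\subsetneq\mathcal{T}_2(\mathrm{Paley}(p))=\mathcal{T}_3(\mathrm{Paley}(p))\subsetneq\mathcal{T}_4(\mathrm{Paley}(p))$.
   Context: For a prime power $q\equiv 1\pmod 4$, $\mathrm{Paley}(q)$ is the Paley graph: its vertex set is the finite field $\mathrm{GF}(q)$, and two vertices $x,y$ are adjacent iff $x-y$ is a nonzero square in $\mathrm{GF}(q)$. For a finite connected simple graph $\Gamma=(X,E)$ with adjacency matrix $A$ and base vertex $x_0\in X$, $M_X(\mathbb{C})$ is the algebra of complex matrices with rows and columns indexed by $X$. For $Y\subset X$, $E_Y$ is the diagonal matrix with $(x,x)$-entry $1$ if $x\in Y$ and $0$ otherwise; $E_x=E_{\{x\}}$. $\mathbb{C}\langle S\rangle$ is the unital $\mathbb{C}$-subalgebra of $M_X(\mathbb{C})$ generated by $S$. Let $X_k=\{x\in X:\partial(x_0,x)=k\}$ ($\partial$ the graph distance), $D=\max_{x}\partial(x_0,x)$, $G_{x_0}$ the stabilizer of $x_0$ in $\mathrm{Aut}(\Gamma)$, and $Y_1,\dots,Y_r$ the $G_{x_0}$-orbits on $X$. Then $\mathcal{T}_1(\Gamma,x_0)=\mathbb{C}\langle A,E_{x_0}\rangle$, $\mathcal{T}_2(\Gamma,x_0)=\mathbb{C}\langle A,E_{X_0},\dots,E_{X_D}\rangle$, $\mathcal{T}_3(\Gamma,x_0)=\mathbb{C}\langle A,E_{Y_1},\dots,E_{Y_r}\rangle$,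 and $\mathcal{T}_4(\Gamma,x_0)=\{M\in M_X(\mathbb{C}): M_{\sigma(x),\sigma(y)}=M_{x,y}\ \text{for all } x,y\in X,\ \sigma\in G_{x_0}\}$. For Paley graphs the base vertex is fixed as $x_0=0$ and $\mathcal{T}_\ell(\mathrm{Paley}(q))$ means $\mathcal{T}_\ell(\mathrm{Paley}(q),0)$. *)

theory Defs
  imports "HOL-Analysis.Finite_Cartesian_Product" "HOL-Number_Theory.Cong"
begin

text \<open>
  A finite graph is given by its adjacency relation on a finite type \<open>'v\<close> of vertices, and
  \<open>M\<^sub>X(\<complex>)\<close> is the type \<^typ>\<open>complex^'v^'v\<close>, with matrix product \<open>**\<close>.
\<close>

type_synonym 'v graph = "'v \<Rightarrow> 'v \<Rightarrow> bool"

subsection \<open>Matrix algebras\<close>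

definition unital_subalgebra :: "(complex^'v::finite^'v) set \<Rightarrow> bool" where
  "unital_subalgebra S \<longleftrightarrow>
     mat 1 \<in> S \<and>
     (\<forall>M\<in>S. \<forall>N\<in>S. M + N \<in> S) \<and>
     (\<forall>c. \<forall>M\<in>S. (\<chi> x y. c * M $ x $ y) \<in> S) \<and>
     (\<forall>M\<in>S. \<forall>N\<in>S. M ** N \<in> S)"

definition generated_algebra :: "(complex^'v::finite^'v) set \<Rightarrow> (complex^'v^'v) set" where
  "generated_algebra S = unital_subalgebra hull S"

definition adjacency_matrix :: "'v graph \<Rightarrow> complex^'v::finite^'v" where
  "adjacency_matrix adj = (\<chi> x y. if adj x y then 1 else 0)"

definition diag_indicator :: "'v set \<Rightarrow> complex^'v::finite^'v" where
  "diag_indicator Y = (\<chi> x y. if x = y \<and> x \<in> Y then 1 else 0)"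

subsection \<open>Distance spheres and orbits of the stabilizer\<close>

text \<open>The graph distance is the length of a shortest walk; it is only meaningful between
  vertices in the same component, so the definitions below are meant for connected graphs.\<close>

definition graph_dist :: "'v graph \<Rightarrow> 'v \<Rightarrow> 'v \<Rightarrow> nat" where
  "graph_dist adj x y = (LEAST n. (adj ^^ n) x y)"

definition sphere_at :: "'v graph \<Rightarrow> 'v \<Rightarrow> nat \<Rightarrow> 'v set" where
  "sphere_at adj x0 k = {x. graph_dist adj x0 x = k}"

definition eccentricity :: "('v::finite) graph \<Rightarrow> 'v \<Rightarrow> nat" where
  "eccentricity adj x0 = Max (range (graph_dist adj x0))"

definition graph_automorphisms :: "'v graph \<Rightarrow> ('v \<Rightarrow> 'v) set" where
  "graph_automorphisms adj = {\<sigma>. bij \<sigma> \<and> (\<forall>x y. adj (\<sigma> x) (\<sigma> y) \<longleftrightarrow> adj x y)}"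

definition vertex_stabilizer :: "'v graph \<Rightarrow> 'v \<Rightarrow> ('v \<Rightarrow> 'v) set" where
  "vertex_stabilizer adj x0 = {\<sigma> \<in> graph_automorphisms adj. \<sigma> x0 = x0}"

definition stabilizer_orbits :: "'v graph \<Rightarrow> 'v \<Rightarrow> 'v set set" where
  "stabilizer_orbits adj x0 = range (\<lambda>x. (\<lambda>\<sigma>. \<sigma> x) ` vertex_stabilizer adj x0)"

subsection \<open>The four algebras\<close>

definition T1_algebra :: "('v::finite) graph \<Rightarrow> 'v \<Rightarrow> (complex^'v^'v) set" where
  "T1_algebra adj x0 = generated_algebra {adjacency_matrix adj, diag_indicator {x0}}"

definition T2_algebra :: "('v::finite) graph \<Rightarrow> 'v \<Rightarrow> (complex^'v^'v) set" where
  "T2_algebra adj x0 = generated_algebra (insert (adjacency_matrix adj)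
     ((\<lambda>k. diag_indicator (sphere_at adj x0 k)) ` {..eccentricity adj x0}))"

definition T3_algebra :: "('v::finite) graph \<Rightarrow> 'v \<Rightarrow> (complex^'v^'v) set" where
  "T3_algebra adj x0 = generated_algebra (insert (adjacency_matrix adj)
     (diag_indicator ` stabilizer_orbits adj x0))"

definition T4_algebra :: "('v::finite) graph \<Rightarrow> 'v \<Rightarrow> (complex^'v^'v) set" where
  "T4_algebra adj x0 =
     {M. \<forall>x y. \<forall>\<sigma>\<in>vertex_stabilizer adj x0. M $ \<sigma> x $ \<sigma> y = M $ x $ y}"

subsection \<open>Paley graphs\<close>

text \<open>The relation is symmetric only if \<open>-1\<close> is a square, for instance if
  \<open>CARD('f) mod 4 = 1\<close>. The field \<open>GF(q)\<close> is any type \<open>'f\<close> of class \<open>{field, finite}\<close> with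
  \<open>CARD('f) = q\<close>.\<close>

definition paley :: "('f::{field,finite}) graph" where
  "paley x y \<longleftrightarrow> x - y \<noteq> 0 \<and> (\<exists>z. x - y = z ^ 2)"

end

theory Submission
  imports Defs "HOL-Computational_Algebra.Polynomial"
begin

text \<open>
  Write \<open>S\<close> and \<open>N\<close> for the nonzero squares and the nonsquares. Multiplication by squares makes both
  classes orbits of the stabilizer of \<open>0\<close>, so \<open>{0}\<close>, \<open>S\<close>, \<open>N\<close> are at the same time the distance spheres
  and the orbits, and \<open>T\<^sub>2 = T\<^sub>3\<close>. Both strict inclusions rest on one character sum: distinct squares
  have distinct sets of neighbours in \<open>N\<close>.

  \<open>T\<^sub>1 \<noteq> T\<^sub>2\<close>: on the vectors orthogonal to the indicators of the three classes every element of \<open>T\<^sub>1\<close>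
  commutes with \<open>A\<close>, while \<open>E\<^sub>S\<close> does not. \<open>T\<^sub>3 \<noteq> T\<^sub>4\<close>: there is an explicit matrix commuting with
  all of \<open>T\<^sub>3\<close> that behaves like the inversion of the multiplicative group; it does not commute with the
  permutation \<open>x \<mapsto> g x\<close> of \<open>S\<close> if \<open>g\<^sup>2 \<noteq> 1\<close>. For prime \<open>p\<close> this permutation matrix is in \<open>T\<^sub>4\<close>, because by
  Carlitz's theorem the stabilizer of \<open>0\<close> consists of the multiplications by squares. That theorem
  follows from the vanishing of the power sums of \<open>f x - c x\<close> for \<open>c \<in> N \<union> {0}\<close>.
\<close>

subsection \<open>Squares and nonsquares\<close>

definition squares :: "'f::{field,finite} set" where
  "squares = {x. x \<noteq> 0 \<and> (\<exists>z. x = z ^ 2)}"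

definition nonsquares :: "'f::{field,finite} set" where
  "nonsquares = {x. x \<noteq> 0 \<and> (\<nexists>z. x = z ^ 2)}"

lemma paley_iff_squares: "paley x y \<longleftrightarrow> x - y \<in> squares"
  by (simp add: paley_def squares_def)

lemma vertex_cases:
  obtains "x = 0" | "x \<in> squares" | "x \<in> nonsquares"
  by (auto simp: squares_def nonsquares_def)

lemma squares_nonsquares_disjoint:
  "x \<in> squares \<Longrightarrow> x \<notin> nonsquares" "x \<in> nonsquares \<Longrightarrow> x \<notin> squares"
  by (auto simp: squares_def nonsquares_def)

lemma zero_notin_squares [simp]: "0 \<notin> squares" "0 \<notin> nonsquares"
  by (auto simp: squares_def nonsquares_def)

lemma sum_field_classes:
  fixes g :: "'f::{field,finite} \<Rightarrow> 'a::comm_monoid_add"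
  shows "sum g UNIV = g 0 + (sum g squares + sum g nonsquares)"
proof -
  have "UNIV = insert 0 (squares \<union> nonsquares :: 'f set)" using vertex_cases by blast
  moreover have "sum g (squares \<union> nonsquares) = sum g squares + sum g nonsquares"
    by (rule sum.union_disjoint) (auto simp: squares_nonsquares_disjoint)
  moreover have "sum g (insert 0 (squares \<union> nonsquares)) = g 0 + sum g (squares \<union> nonsquares)"
    by (rule sum.insert) auto
  ultimately show ?thesis by metis
qed

lemma power2_in_squares: "z \<noteq> 0 \<Longrightarrow> z ^ 2 \<in> squares"
  by (auto simp: squares_def)

lemma one_in_squares: "1 \<in> squares"
  using power2_in_squares[of 1] by simp

text \<open>Multiplication by \<open>x\<close> permutes the nonzero elements, so their product,
  itself nonzero, absorbs the factor.\<close>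

lemma power_card_minus_one_eq_one:
  fixes x :: "'f::{field,finite}"
  assumes "x \<noteq> 0"
  shows "x ^ (CARD('f) - 1) = 1"
proof -
  have "x ^ (CARD('f) - 1) * \<Prod>(UNIV - {0}) = (\<Prod>y\<in>UNIV-{0}. x * y)"
    by (simp add: prod.distrib)
  also have "\<dots> = (\<Prod>y\<in>UNIV-{0}. y)"
    by (rule prod.reindex_bij_witness[of _ "\<lambda>y. y / x" "\<lambda>y. x * y"]) (use assms in auto)
  finally show ?thesis
    by simp
qed

text \<open>Translation by \<open>1\<close> permutes the field, hence leaves the sum of all elements
  unchanged.\<close>

lemma of_nat_card_eq_zero: "of_nat (CARD('f)) = (0 :: 'f::{field,finite})"
proof -
  have "(\<Sum>x\<in>(UNIV::'f set). x + 1) = (\<Sum>x\<in>UNIV. x)"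
    by (rule sum.reindex_bij_witness[of _ "\<lambda>y. y - 1" "\<lambda>y. y + 1"]) auto
  then show ?thesis by (simp add: sum.distrib)
qed

subsection \<open>Quadratic residues in a field of odd order\<close>

context
  fixes m :: nat
  assumes card_eq: "CARD('f::{field,finite}) = 2 * m + 1"
begin

lemma two_neq_zero: "(2::'f) \<noteq> 0"
proof
  assume "(2::'f) = 0"
  moreover have "of_nat (2 * m + 1) = 2 * of_nat m + (1::'f)" by simp
  moreover have "of_nat (2 * m + 1) = (0::'f)"
    using of_nat_card_eq_zero[where 'f = 'f] unfolding card_eq .
  ultimately show False by (simp only: mult_zero_left add_0_left zero_neq_one)
qed

lemma half_power_sq: "x \<noteq> 0 \<Longrightarrow> (x::'f) ^ m = 1 \<or> x ^ m = -1"
  using power_card_minus_one_eq_one[of x] card_eq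
  by (simp add: power_mult power_commuting_commutes mult.commute[of 2 m])
     (simp add: power2_eq_1_iff)

lemma half_pos: "m > 0"
proof (rule ccontr)
  assume "\<not> m > 0"
  then have "CARD('f) = 1" using card_eq by simp
  then obtain a :: 'f where "UNIV = {a}" by (auto simp: card_1_singleton_iff)
  then have "(0::'f) = 1" by (metis UNIV_I singletonD)
  then show False by simp
qed

lemma card_squares: "card (squares :: 'f set) = m"
proof -
  have "2 * m = card (UNIV - {0::'f})" using card_eq by simp
  also have "UNIV - {0::'f} = (\<Union>s\<in>squares. {z. z ^ 2 = s})"
    by (auto simp: squares_def)
  also have "card \<dots> = (\<Sum>s\<in>(squares::'f set). card {z. z ^ 2 = s})"
    by (rule card_UN_disjoint) auto
  also have "\<dots> = (\<Sum>s\<in>(squares::'f set). 2)"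
  proof (rule sum.cong)
    fix s :: 'f assume "s \<in> squares"
    then obtain z where z: "s = z ^ 2" "z \<noteq> 0" by (auto simp: squares_def)
    have "{w. w ^ 2 = s} = {z, -z}" using z by (auto simp: power2_eq_iff)
    moreover have "z \<noteq> - z" 
    proof
      assume "z = - z"
      then have "2 * z = 0" by (metis add.right_inverse mult_2)
      then show False using z two_neq_zero by simp
    qed
    ultimately show "card {w. w ^ 2 = s} = 2" by simp
  qed simp
  finally show ?thesis by simp
qed

text \<open>Euler's criterion: the squares are roots of \<open>X^m - 1\<close>, and there are
  already \<open>m\<close> of them. The sign rules for products and quotients then reduce to
  multiplicativity of \<open>x ^ m\<close>.\<close>

lemma squares_eq_half_power: "(squares :: 'f set) = {x. x ^ m = 1}"
proof (rule card_seteq)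
  show "squares \<subseteq> {x::'f. x ^ m = 1}"
  proof
    fix x :: 'f assume "x \<in> squares"
    then obtain z where z: "x = z ^ 2" "z \<noteq> 0" by (auto simp: squares_def)
    have "x ^ m = z ^ (CARD('f) - 1)" using z card_eq by (simp add: power_mult)
    then show "x \<in> {x. x ^ m = 1}" using power_card_minus_one_eq_one z by simp
  qed
  let ?P = "monom 1 m - 1 :: 'f poly"
  have c: "coeff ?P m = 1" using half_pos by simp
  then have "?P \<noteq> 0" by (metis coeff_0 zero_neq_one)
  then have "card {x. poly ?P x = 0} \<le> degree ?P" by (rule card_poly_roots_bound)
  also have "degree ?P \<le> m"
    by (rule degree_diff_le) (auto simp: degree_monom_le)
  also have "{x. poly ?P x = 0} = {x. x ^ m = 1}" by (simp add: poly_monom)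
  finally show "card {x::'f. x ^ m = 1} \<le> card (squares::'f set)"
    by (simp add: card_squares)
qed simp

lemma one_neq_minus_one: "(1::'f) \<noteq> -1"
  using two_neq_zero by (metis add.right_inverse one_add_one)

lemma nonsquares_eq_half_power: "(nonsquares :: 'f set) = {x. x ^ m = -1}"
proof -
  have "x \<in> nonsquares \<longleftrightarrow> x ^ m = -1" for x :: 'f
  proof (cases "x = 0")
    case True
    then show ?thesis using half_pos by (simp add: zero_power)
  next
    case False
    then have "x \<in> nonsquares \<longleftrightarrow> x \<notin> squares" by (auto simp: squares_def nonsquares_def)
    then show ?thesis
      using half_power_sq[OF False] one_neq_minus_one by (auto simp: squares_eq_half_power)
  qed
  then show ?thesis by auto
qed

lemma squares_mult:
  fixes x y :: 'f
  shows "x \<in> squares \<Longrightarrow> y \<in> squares \<Longrightarrow> x * y \<in> squares"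
    and "x \<in> squares \<Longrightarrow> y \<in> nonsquares \<Longrightarrow> x * y \<in> nonsquares"
    and "x \<in> nonsquares \<Longrightarrow> y \<in> squares \<Longrightarrow> x * y \<in> nonsquares"
    and "x \<in> nonsquares \<Longrightarrow> y \<in> nonsquares \<Longrightarrow> x * y \<in> squares"
  by (auto simp: squares_eq_half_power nonsquares_eq_half_power power_mult_distrib)

lemma squares_divide:
  fixes x y :: 'f
  shows "x \<in> squares \<Longrightarrow> y \<in> squares \<Longrightarrow> x / y \<in> squares"
    and "x \<in> squares \<Longrightarrow> y \<in> nonsquares \<Longrightarrow> x / y \<in> nonsquares"
    and "x \<in> nonsquares \<Longrightarrow> y \<in> squares \<Longrightarrow> x / y \<in> nonsquares"
    and "x \<in> nonsquares \<Longrightarrow> y \<in> nonsquares \<Longrightarrow> x / y \<in> squares"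
  by (auto simp: squares_eq_half_power nonsquares_eq_half_power power_divide)

lemma mult_squares_iff:
  fixes x y :: 'f
  assumes "x \<in> squares"
  shows "x * y \<in> squares \<longleftrightarrow> y \<in> squares" "x * y \<in> nonsquares \<longleftrightarrow> y \<in> nonsquares"
  using assms by (auto simp: squares_eq_half_power nonsquares_eq_half_power power_mult_distrib)

lemma card_nonsquares: "card (nonsquares :: 'f set) = m"
proof -
  have "card (insert 0 (squares \<union> nonsquares) :: 'f set) = 1 + (m + card (nonsquares :: 'f set))"
    by (subst card_insert_disjoint, simp_all, subst card_Un_disjoint)
       (auto simp: card_squares squares_nonsquares_disjoint)
  moreover have "insert 0 (squares \<union> nonsquares) = (UNIV :: 'f set)"
    using vertex_cases by blast
  ultimately show ?thesis using card_eq by simp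
qed

text \<open>The quadratic character \<open>\<eta>\<close> satisfies \<open>\<Sum>\<^sub>z \<eta>(z - x) \<eta>(z - y) = -1\<close> for \<open>x \<noteq> y\<close>, because
  the product is \<open>\<eta>((z - x) / (z - y))\<close> and this quotient takes every value but \<open>1\<close>. If \<open>x\<close> and
  \<open>y\<close> had the same neighbours among the nonsquares, then \<open>0\<close> and all \<open>m\<close> nonsquares would
  contribute \<open>1\<close>, which the \<open>m - 2\<close> squares other than \<open>x\<close> and \<open>y\<close> cannot compensate.\<close>

lemma squares_separated_by_nonsquares:
  fixes x y :: 'f
  assumes x: "x \<in> squares" and y: "y \<in> squares" and neg1: "(-1::'f) \<in> squares"
    and same: "\<And>z. z \<in> nonsquares \<Longrightarrow> x - z \<in> squares \<longleftrightarrow> y - z \<in> squares"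
  shows "x = y"
proof (rule ccontr)
  assume ne: "x \<noteq> y"
  define eta :: "'f \<Rightarrow> int"
    where "eta w = (if w = 0 then 0 else if w \<in> squares then 1 else -1)" for w
  have eta_mult: "eta (v * w) = eta v * eta w" for v w :: 'f
    by (cases v rule: vertex_cases; cases w rule: vertex_cases)
       (auto simp: eta_def squares_nonsquares_disjoint squares_mult)
  have eta_sq: "w \<noteq> 0 \<Longrightarrow> eta w * eta w = 1" for w :: 'f
    by (auto simp: eta_def)
  have eta_quot: "eta (v / w) = eta v * eta w" if "w \<noteq> 0" for v w :: 'f
  proof -
    have "eta v * eta w = eta (v / w) * (eta w * eta w)"
      using that eta_mult[of "v / w" w] by (simp add: mult.assoc)
    then show ?thesis using eta_sq[OF that] by simp
  qed
  let ?g = "\<lambda>z. eta (z - x) * eta (z - y)"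
  have sum_eta: "sum eta UNIV = 0"
  proof -
    have "sum eta UNIV = sum eta squares + sum eta nonsquares"
      unfolding sum_field_classes by (simp add: eta_def)
    also have "sum eta squares = (\<Sum>z\<in>(squares::'f set). 1)"
      by (rule sum.cong) (auto simp: eta_def squares_def)
    also have "sum eta nonsquares = (\<Sum>z\<in>(nonsquares::'f set). -1)"
      by (rule sum.cong) (auto simp: eta_def squares_def nonsquares_def)
    finally show ?thesis by (simp add: card_squares card_nonsquares)
  qed
  have "sum ?g UNIV = sum ?g (UNIV - {y})"
    by (rule sum.mono_neutral_right) (auto simp: eta_def)
  also have "\<dots> = sum eta (UNIV - {1})"
  \<comment> \<open>The quotient \<open>(z - x) / (z - y)\<close> in the form
    \<open>1 + (y - x) / (z - y)\<close>, which shows both its inverse and that it misses only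
    \<open>1\<close>.\<close>
  proof (rule sum.reindex_bij_witness[of _ "\<lambda>u. y + (y - x) / (u - 1)" "\<lambda>z. 1 + (y - x) / (z - y)"])
    fix z assume "z \<in> UNIV - {y}"
    then have "1 + (y - x) / (z - y) = (z - x) / (z - y)" "z - y \<noteq> 0" by (auto simp: field_simps)
    then show "eta (1 + (y - x) / (z - y)) = ?g z" by (simp add: eta_quot)
  qed (use ne in auto)
  also have "\<dots> = sum eta UNIV - eta 1"
    by (subst sum_diff1) auto
  also have "\<dots> = -1"
    using sum_eta one_in_squares by (simp add: eta_def)
  finally have total: "sum ?g UNIV = -1" .
  have neg: "eta (- w) = eta w" for w :: 'f
    using eta_mult[of "-1" w] neg1 by (simp add: eta_def[of "-1"])
  have one: "?g z = 1" if "z = 0 \<or> z \<in> nonsquares" for z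
  proof (cases "z = 0")
    case True
    then show ?thesis using x y neg[of x] neg[of y] by (simp add: eta_def[of x] eta_def[of y]) auto
  next
    case False
    then have z: "z \<in> nonsquares" using that by simp
    then have zx: "x - z \<noteq> 0" "y - z \<noteq> 0"
      using x y squares_nonsquares_disjoint by auto
    then have "eta (x - z) = eta (y - z)" using same[OF z] by (simp add: eta_def)
    then have "eta (z - x) = eta (z - y)" using neg[of "x - z"] neg[of "y - z"] by simp
    then show ?thesis using eta_sq[of "z - y"] zx by simp
  qed
  have "sum ?g UNIV = sum ?g (UNIV - {x, y})"
    by (rule sum.mono_neutral_right) (auto simp: eta_def)
  also have "UNIV - {x, y} = (insert 0 nonsquares) \<union> (squares - {x, y})"
  proof -
    have "z \<in> UNIV - {x, y} \<longleftrightarrow> z \<in> insert 0 nonsquares \<union> (squares - {x, y})" for z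
      using x y by (cases z rule: vertex_cases) (auto simp: squares_nonsquares_disjoint)
    then show ?thesis by blast
  qed
  also have "sum ?g \<dots> = sum ?g (insert 0 nonsquares) + sum ?g (squares - {x, y})"
    by (rule sum.union_disjoint) (auto simp: squares_nonsquares_disjoint)
  also have "sum ?g (insert 0 nonsquares) = (\<Sum>z\<in>insert 0 (nonsquares::'f set). 1)"
    by (rule sum.cong) (use one in auto)
  also have "\<dots> = int m + 1" by (simp add: card_nonsquares)
  finally have "sum ?g UNIV = int m + 1 + sum ?g (squares - {x, y})" .
  moreover have "sum ?g (squares - {x, y}) \<ge> (\<Sum>z\<in>squares - {x, y}. -1)"
    by (rule sum_mono) (auto simp: eta_def)
  moreover have "(\<Sum>z\<in>squares - {x, y}. -1::int) = - int (card (squares - {x, y}))" by simp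
  \<comment> \<open>The crude bound \<open>m\<close> suffices: the total is then at least
    \<open>1\<close>, against \<open>-1\<close>.\<close>
  moreover have "card (squares - {x, y}) \<le> m"
    using card_mono[of squares "squares - {x, y}"] by (simp add: card_squares)
  ultimately show False using total by simp
qed

end

subsection \<open>Carlitz's theorem over a prime field\<close>

text \<open>For \<open>k > 0\<close> some nonzero \<open>a\<close> has
  \<open>a ^ k \<noteq> 1\<close>, since \<open>X^k - 1\<close> has at most \<open>k\<close> roots;
  substituting \<open>a * x\<close> for \<open>x\<close> multiplies the sum by \<open>a ^ k\<close>
  without changing it. For \<open>k = 0\<close> every term is \<open>1\<close>, also at
  \<open>x = 0\<close>.\<close>

lemma sum_power_eq_zero:
  assumes "k < CARD('f) - 1"
  shows "(\<Sum>x\<in>(UNIV::'f::{field,finite} set). x ^ k) = 0"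
proof (cases "k = 0")
  case True
  then show ?thesis by (simp add: of_nat_card_eq_zero)
next
  case False
  have "\<exists>a::'f. a \<noteq> 0 \<and> a ^ k \<noteq> 1"
  proof (rule ccontr)
    let ?P = "monom 1 k - 1 :: 'f poly"
    assume "\<nexists>a::'f. a \<noteq> 0 \<and> a ^ k \<noteq> 1"
    then have "UNIV - {0} \<subseteq> {x. poly ?P x = 0}" by (auto simp: poly_monom)
    then have "CARD('f) - 1 \<le> card {x. poly ?P x = 0}"
      using card_mono[of "{x. poly ?P x = 0}" "UNIV - {0}"] by simp
    also have "coeff ?P k = 1" using False by simp
    then have "?P \<noteq> 0" by (metis coeff_0 zero_neq_one)
    then have "card {x. poly ?P x = 0} \<le> degree ?P" by (rule card_poly_roots_bound)
    also have "degree ?P \<le> k" by (rule degree_diff_le) (auto simp: degree_monom_le)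
    finally show False using assms by simp
  qed
  then obtain a :: 'f where a: "a \<noteq> 0" "a ^ k \<noteq> 1" by blast
  have "(\<Sum>x\<in>UNIV. x ^ k) = (\<Sum>x\<in>UNIV. (a * x) ^ k)"
    by (rule sum.reindex_bij_witness[of _ "\<lambda>x. a * x" "\<lambda>x. x / a"]) (use a in auto)
  also have "\<dots> = a ^ k * (\<Sum>x\<in>UNIV. x ^ k)"
    by (simp add: power_mult_distrib sum_distrib_left)
  finally show ?thesis using a by simp
qed

lemma sum_power_card_minus_one:
  "(\<Sum>x\<in>(UNIV::'f::{field,finite} set). x ^ (CARD('f) - 1)) = -1"
proof -
  have U: "(UNIV::'f set) = insert 0 (UNIV - {0})" by auto
  have two: "CARD('f) \<ge> 2"
    using card_mono[of "UNIV::'f set" "{0, 1}"] by simp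
  have "(\<Sum>x\<in>(UNIV::'f set). x ^ (CARD('f) - 1)) = (\<Sum>x\<in>UNIV - {0::'f}. x ^ (CARD('f) - 1))"
    by (rule sum.mono_neutral_right) (use two in \<open>auto simp: zero_power\<close>)
  also have "\<dots> = (\<Sum>x\<in>UNIV - {0::'f}. 1)"
    by (rule sum.cong) (auto simp: power_card_minus_one_eq_one[simplified])
  also have "\<dots> = of_nat (CARD('f)) - 1"
    using two by (simp add: of_nat_diff)
  finally show ?thesis by (simp add: of_nat_card_eq_zero)
qed

section \<open>Sums of polynomial values and interpolation over a finite field\<close>

lemma poly_eq_sum_atMost:
  fixes P :: "'a::comm_semiring_1 poly"
  assumes "degree P \<le> n"
  shows "poly P x = (\<Sum>i\<le>n. coeff P i * x ^ i)"
  unfolding poly_altdef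
  by (rule sum.mono_neutral_left) (use assms in \<open>auto simp: coeff_eq_0\<close>)

lemma sum_poly_eq_coeff:
  fixes P :: "'f::{field,finite} poly"
  assumes "degree P \<le> CARD('f) - 1"
  shows "(\<Sum>x\<in>UNIV. poly P x) = - coeff P (CARD('f) - 1)"
proof -
  let ?n = "CARD('f) - 1"
  have "(\<Sum>x\<in>UNIV. poly P x) = (\<Sum>x\<in>UNIV. \<Sum>i\<le>?n. coeff P i * x ^ i)"
    using assms by (simp add: poly_eq_sum_atMost)
  also have "\<dots> = (\<Sum>i\<le>?n. coeff P i * (\<Sum>x\<in>UNIV. x ^ i))"
    by (subst sum.swap) (simp add: sum_distrib_left)
  also have "\<dots> = (\<Sum>i\<in>{?n}. coeff P i * (\<Sum>x\<in>UNIV. x ^ i))"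
    by (rule sum.mono_neutral_right) (auto simp: sum_power_eq_zero)
  finally show ?thesis using sum_power_card_minus_one[where 'f = 'f] by simp
qed

lemma exists_interpolating_poly:
  fixes f :: "'f::{field,finite} \<Rightarrow> 'f"
  obtains P where "degree P \<le> CARD('f) - 1" "\<And>x. poly P x = f x"
proof
  let ?n = "CARD('f) - 1"
  \<comment> \<open>With \<open>q\<close> the field order, \<open>1 - (X - a)^(q - 1)\<close> takes
    the value \<open>1\<close> at \<open>a\<close> and \<open>0\<close> elsewhere.\<close>
  let ?P = "\<Sum>a\<in>UNIV. smult (f a) (1 - [:-a, 1:] ^ ?n)"
  have n: "?n > 0"
    using card_mono[of "UNIV::'f set" "{0, 1}"] by simp
  show "degree ?P \<le> ?n"
    by (intro degree_sum_le order_trans[OF degree_smult_le] degree_diff_le)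
       (auto simp: degree_linear_power simp del: One_nat_def)
  fix x
  have "poly ?P x = (\<Sum>a\<in>UNIV. if a = x then f a else 0)"
    unfolding poly_sum
    by (rule sum.cong) (use n power_card_minus_one_eq_one[where 'f = 'f] in \<open>auto simp: zero_power simp del: One_nat_def\<close>)
  then show "poly ?P x = f x" by simp
qed

text \<open>This is where primality enters: the characteristic is the field order itself, and a
  prime does not divide \<open>fact k\<close> for smaller \<open>k\<close>.\<close>

lemma of_nat_choose_neq_zero:
  assumes "prime (CARD('f))" "j \<le> k" "k < CARD('f)"
  shows "of_nat (k choose j) \<noteq> (0 :: 'f::{field,finite})"
proof
  assume "of_nat (k choose j) = (0 :: 'f)"
  then have "CHAR('f) dvd (k choose j)" by (simp add: of_nat_eq_0_iff_char_dvd)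
  moreover have "CHAR('f) dvd CARD('f)"
    using of_nat_card_eq_zero[where 'f = 'f] by (simp add: of_nat_eq_0_iff_char_dvd)
  then have "CHAR('f) = CARD('f)"
    using assms(1) CHAR_not_1[where 'a = 'f] by (auto simp: prime_nat_iff)
  moreover have "(k choose j) dvd fact k"
    using assms(2) by (metis binomial_fact_lemma dvd_triv_right)
  ultimately have "CARD('f) dvd fact k" by (metis dvd_trans)
  then show False using assms by (simp add: prime_dvd_fact_iff)
qed

text \<open>For \<open>c \<in> N \<union> {0}\<close>, with \<open>N\<close> the nonsquares, the map \<open>x \<mapsto> f x - c x\<close> is a permutation, so
  its power sums of exponent \<open>k \<le> m + 1 < p - 1\<close> vanish. As a polynomial in \<open>c\<close> such a power sum
  has degree below \<open>k\<close> (its leading coefficient is the power sum of the identity) and \<open>m + 1\<close> roots,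
  so all its coefficients are zero.\<close>

lemma mixed_moment_eq_zero:
  fixes f :: "'f::{field,finite} \<Rightarrow> 'f"
  assumes card: "CARD('f) = 2 * m + 1" and m: "m > 1" and prime: "prime (CARD('f))"
    and f: "\<And>x y. f x - f y \<in> squares \<longleftrightarrow> x - y \<in> squares" and inj: "inj f"
    and ij: "0 < i + j" "i + j \<le> m + 1"
  shows "(\<Sum>x\<in>UNIV. x ^ i * f x ^ j) = 0"
proof -
  define k where "k = i + j"
  have k: "0 < k" "k \<le> m + 1" "k < CARD('f) - 1" "k < CARD('f)"
    using ij card m by (auto simp: k_def)
  define s where "s i = (\<Sum>x\<in>UNIV. x ^ i * f x ^ (k - i))" for i
  \<comment> \<open>The binomial expansion of the \<open>k\<close>-th power sum of
    \<open>f x - c * x\<close>, read as a polynomial in \<open>c\<close>.\<close>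
  define Q where "Q = (\<Sum>i\<le>k. monom (of_nat (k choose i) * (-1) ^ i * s i) i)"
  have coeff_Q: "coeff Q i = (if i \<le> k then of_nat (k choose i) * (-1) ^ i * s i else 0)" for i
    by (simp add: Q_def coeff_sum)
  have "s k = 0" using k by (simp add: s_def sum_power_eq_zero)
  have "degree Q < k"
    by (rule degree_lessI) (use k \<open>s k = 0\<close> coeff_Q in auto)
  have Q_root: "poly Q c = 0" if c: "c = 0 \<or> c \<in> nonsquares" for c
  proof -
    have "inj (\<lambda>x. f x - c * x)"
    proof
      fix x y assume "f x - c * x = f y - c * y"
      then have eq: "f x - f y = c * (x - y)" by (simp add: algebra_simps)
      show "x = y"
      proof (cases "c = 0")
        case True
        then show ?thesis using eq inj by (simp add: inj_eq)
      next
        case False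
        then have c: "c \<in> nonsquares" using c by simp
        show ?thesis
        \<comment> \<open>Multiplication by the nonsquare \<open>c\<close> swaps the two classes,
          while \<open>f\<close> preserves whether a difference is a square; so \<open>x - y\<close>
          lies in neither class.\<close>
        proof (cases "x - y" rule: vertex_cases)
          case 2
          then have "c * (x - y) \<in> nonsquares" by (rule squares_mult(3)[OF card c])
          then show ?thesis using f[of x y] 2 eq by (simp add: squares_nonsquares_disjoint)
        next
          case 3
          then have "c * (x - y) \<in> squares" by (rule squares_mult(4)[OF card c])
          then show ?thesis using f[of x y] 3 eq by (simp add: squares_nonsquares_disjoint)
        qed simp
      qed
    qed
    then have "bij (\<lambda>x. f x - c * x)" by (simp add: bij_def finite_UNIV_inj_surj)
    have "poly Q c = (\<Sum>i\<le>k. of_nat (k choose i) * (-1) ^ i * s i * c ^ i)"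
      by (simp add: Q_def poly_sum poly_monom)
    also have "\<dots> = (\<Sum>x\<in>UNIV. \<Sum>i\<le>k. of_nat (k choose i) * (- (c * x)) ^ i * f x ^ (k - i))"
    proof -
      have "(- (c * x)) ^ i = (-1) ^ i * (c ^ i * x ^ i)" for x i
        by (simp only: power_minus[of "c * x"] power_mult_distrib)
      then show ?thesis
        by (subst sum.swap) (simp add: s_def sum_distrib_left sum_distrib_right mult_ac)
    qed
    also have "\<dots> = (\<Sum>x\<in>UNIV. (f x - c * x) ^ k)"
      by (subst binomial_ring[symmetric]) simp
    also have "\<dots> = (\<Sum>x\<in>UNIV. x ^ k)"
      by (rule sum.reindex_bij_betw[OF \<open>bij (\<lambda>x. f x - c * x)\<close>, of "\<lambda>x. x ^ k"])
    also have "\<dots> = 0" by (rule sum_power_eq_zero) fact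
    finally show ?thesis .
  qed
  have "card (insert 0 nonsquares :: 'f set) = m + 1"
    using card_nonsquares[OF card] by simp
  then have "Q = 0"
    using Q_root \<open>degree Q < k\<close> k
    by (intro poly_eqI_degree[of "insert 0 nonsquares"]) auto
  then have "coeff Q i = 0" by simp
  moreover have "of_nat (k choose i) \<noteq> (0::'f)"
    using prime k by (intro of_nat_choose_neq_zero) (auto simp: k_def)
  ultimately have "s i = 0" using coeff_Q[of i] by (simp add: k_def)
  then show ?thesis by (simp add: s_def k_def)
qed

text \<open>If the interpolating polynomial \<open>P\<close> of \<open>f\<close> had degree \<open>d \<ge> 2\<close>, then with
  \<open>2 * m = a * d + r\<close> the polynomial \<open>X\<^sup>r P\<^sup>a\<close> would have degree exactly \<open>p - 1\<close>, hence a nonzero sum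
  of values, although \<open>a + r \<le> m + 1\<close>.\<close>

lemma square_difference_preserving_imp_linear:
  fixes f :: "'f::{field,finite} \<Rightarrow> 'f"
  assumes card: "CARD('f) = 2 * m + 1" and m: "m > 1" and prime: "prime (CARD('f))"
    and f: "\<And>x y. f x - f y \<in> squares \<longleftrightarrow> x - y \<in> squares" and inj: "inj f" and f0: "f 0 = 0"
  obtains a where "\<And>x. f x = a * x"
proof -
  obtain P where P: "degree P \<le> CARD('f) - 1" "\<And>x. poly P x = f x"
    using exists_interpolating_poly by blast
  have "degree P \<le> 1"
  proof (rule ccontr)
    define d where "d = degree P"
    define a where "a = 2 * m div d"
    define r where "r = 2 * m mod d"
    assume "\<not> degree P \<le> 1"
    then have d: "d \<ge> 2" "P \<noteq> 0" by (auto simp: d_def)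
    have "d \<le> 2 * m" using P card by (simp add: d_def)
    then have "a \<ge> 1" using d by (simp add: a_def div_greater_zero_iff Suc_le_eq)
    have "r < d" using d by (simp add: r_def)
    have eq: "2 * m = a * d + r" by (simp add: a_def r_def)
    \<comment> \<open>This is \<open>(a - 1) * (d - 2) \<ge> 0\<close>; with \<open>r < d\<close> it
      gives \<open>2 * m \<ge> 2 * (a + r) - 1\<close>.\<close>
    have "a * d \<ge> 2 * a + (d - 2)"
    proof -
      obtain a' d' where "a = Suc a'" "d = d' + 2"
        using \<open>a \<ge> 1\<close> d by (metis Suc_le_D One_nat_def le_add_diff_inverse2)
      then show ?thesis by (simp add: algebra_simps)
    qed
    then have bound: "r + a \<le> m + 1" using eq \<open>r < d\<close> d by linarith
    let ?R = "monom 1 r * P ^ a"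
    have "degree ?R = 2 * m"
      using d by (simp add: degree_mult_eq degree_power_eq degree_monom_eq eq d_def)
    moreover have "?R \<noteq> 0" using d by simp
    ultimately have "coeff ?R (2 * m) \<noteq> 0" by (metis leading_coeff_0_iff)
    moreover have "(\<Sum>x\<in>UNIV. poly ?R x) = - coeff ?R (2 * m)"
      using sum_poly_eq_coeff[of ?R] \<open>degree ?R = 2 * m\<close> card by simp
    moreover have "(\<Sum>x\<in>UNIV. poly ?R x) = (\<Sum>x\<in>UNIV. x ^ r * f x ^ a)"
      by (simp add: poly_monom P)
    moreover have "\<dots> = 0"
      using mixed_moment_eq_zero[OF card m prime f inj, of r a] bound \<open>a \<ge> 1\<close> by simp
    ultimately show False by simp
  qed
  then have "poly P x = coeff P 0 + coeff P 1 * x" for x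
    using poly_eq_sum_atMost[of P 1 x] by simp
  then have "f x = coeff P 1 * x" for x
    using P(2)[of x] P(2)[of 0] f0 by simp
  then show thesis by (rule that)
qed

subsection \<open>Generated matrix algebras\<close>

lemma generated_algebra_minimal:
  "G \<subseteq> F \<Longrightarrow> unital_subalgebra F \<Longrightarrow> generated_algebra G \<subseteq> F"
  unfolding generated_algebra_def by (rule hull_minimal)

lemma generated_algebra_superset: "G \<subseteq> generated_algebra G"
  unfolding generated_algebra_def by (rule hull_subset)

lemma generated_algebra_mono: "G \<subseteq> H \<Longrightarrow> generated_algebra G \<subseteq> generated_algebra H"
  unfolding generated_algebra_def by (rule hull_mono)

lemma scaled_matrix_mult:
  fixes M N :: "complex^'v::finite^'v"
  shows "(\<chi> x y. c * M $ x $ y) ** N = (\<chi> x y. c * (M ** N) $ x $ y)"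
    and "N ** (\<chi> x y. c * M $ x $ y) = (\<chi> x y. c * (N ** M) $ x $ y)"
    and "(\<chi> x y. c * M $ x $ y) *v v = c *s (M *v v)"
  by (simp_all add: matrix_matrix_mult_def matrix_vector_mult_def vec_eq_iff sum_distrib_left mult_ac)

lemma matrix_add_mult_distrib:
  fixes M N P :: "complex^'v::finite^'v"
  shows "(M + N) ** P = M ** P + N ** P"
  by (simp add: matrix_matrix_mult_def vec_eq_iff sum.distrib distrib_right)

text \<open>Excludes a matrix from a generated algebra once some \<open>U\<close> commutes with all
  generators but not with it.\<close>

lemma unital_subalgebra_centralizer:
  "unital_subalgebra {M :: complex^'v::finite^'v. M ** U = U ** M}"
  unfolding unital_subalgebra_def
  by (auto simp: matrix_add_ldistrib matrix_add_mult_distrib scaled_matrix_mult)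
     (metis matrix_mul_assoc)

text \<open>Invariance of \<open>W\<close> is part of the set because closure under products needs
  the inner factor to stay in \<open>W\<close>.\<close>

lemma unital_subalgebra_commuting_on_invariant:
  fixes A :: "complex^'v::finite^'v"
  assumes add: "\<And>v w. v \<in> W \<Longrightarrow> w \<in> W \<Longrightarrow> v + w \<in> W"
    and scale: "\<And>c v. v \<in> W \<Longrightarrow> c *s v \<in> W"
  shows "unital_subalgebra {M. \<forall>v\<in>W. M *v v \<in> W \<and> M *v (A *v v) = A *v (M *v v)}"
  unfolding unital_subalgebra_def
  by (auto simp: matrix_vector_mult_add_rdistrib matrix_vector_right_distrib scaled_matrix_mult
      add scale vector_scalar_commute simp flip: matrix_vector_mul_assoc)

lemma unital_subalgebra_T4: "unital_subalgebra (T4_algebra adj x0)"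
proof -
  have "(M ** N) $ \<sigma> x $ \<sigma> y = (M ** N) $ x $ y"
    if M: "M \<in> T4_algebra adj x0" and N: "N \<in> T4_algebra adj x0"
      and s: "\<sigma> \<in> vertex_stabilizer adj x0"
    for M N \<sigma> x y
  proof -
    have "bij \<sigma>" using s by (simp add: vertex_stabilizer_def graph_automorphisms_def)
    then have "(\<Sum>z\<in>UNIV. M $ \<sigma> x $ z * N $ z $ \<sigma> y) = (\<Sum>z\<in>UNIV. M $ \<sigma> x $ \<sigma> z * N $ \<sigma> z $ \<sigma> y)"
      by (rule sum.reindex_bij_betw[symmetric])
    then show ?thesis using M N s by (simp add: matrix_matrix_mult_def T4_algebra_def)
  qed
  moreover have "mat 1 \<in> T4_algebra adj x0"
    by (auto simp: T4_algebra_def mat_def vertex_stabilizer_def graph_automorphisms_def bij_def inj_eq)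
  ultimately show ?thesis
    unfolding unital_subalgebra_def by (auto simp: T4_algebra_def)
qed

subsection \<open>Matrices indexed by a finite field\<close>

lemma adjacency_matrix_paley:
  "adjacency_matrix paley $ x $ y = (if x - y \<in> squares then 1 else 0)"
  by (simp add: adjacency_matrix_def paley_iff_squares)

lemma diag_indicator_mult_nth:
  "(diag_indicator Y ** M) $ x $ y = (if x \<in> Y then M $ x $ y else 0)"
  "(M ** diag_indicator Y) $ x $ y = (if y \<in> Y then M $ x $ y else 0)"
  "(diag_indicator Y *v v) $ x = (if x \<in> Y then v $ x else 0)"
proof -
  show "(diag_indicator Y ** M) $ x $ y = (if x \<in> Y then M $ x $ y else 0)"
    by (simp add: matrix_matrix_mult_def diag_indicator_def if_distribR if_distrib cong: if_cong)
  show "(M ** diag_indicator Y) $ x $ y = (if y \<in> Y then M $ x $ y else 0)"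
    by (cases "y \<in> Y")
       (simp_all add: matrix_matrix_mult_def diag_indicator_def if_distribR if_distrib cong: if_cong conj_cong)
  show "(diag_indicator Y *v v) $ x = (if x \<in> Y then v $ x else 0)"
    by (simp add: matrix_vector_mult_def diag_indicator_def if_distribR if_distrib cong: if_cong)
qed

definition balanced :: "(complex^'f::{field,finite}) set" where
  "balanced = {v. v $ 0 = 0 \<and> (\<Sum>x\<in>squares. v $ x) = 0 \<and> (\<Sum>x\<in>nonsquares. v $ x) = 0}"

text \<open>A matrix commuting with \<open>A\<close> and with the class projections: on the squares it is \<open>b(x y)\<close>, on the
  nonsquares \<open>n s, n t\<close> it is \<open>b(1/(s t))\<close>, where \<open>b(u)\<close> says that \<open>u\<close> and \<open>n\<close> are adjacent. Commuting
  with \<open>A\<close> between the two classes amounts to the commutativity of the convolution \<open>b \<star> b\<^sup>*\<close>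
  in the group algebra of the squares.\<close>

definition twist :: "'f \<Rightarrow> complex^'f::{field,finite}^'f::{field,finite}" where
  "twist n = (\<chi> x y.
     if x = 0 \<and> y = 0 then of_nat (card {z \<in> squares. z - n \<in> squares})
     else if x \<in> squares \<and> y \<in> squares then of_bool (x * y - n \<in> squares)
     else if x \<in> nonsquares \<and> y \<in> nonsquares then of_bool (1 - x * y / n \<in> squares)
     else 0)"

text \<open>For a square \<open>g\<close> this is the indicator of the orbit of the pair
  \<open>(g, 1)\<close> under multiplications by squares.\<close>

definition dilation_on_squares :: "'f \<Rightarrow> complex^'f::{field,finite}^'f::{field,finite}" where
  "dilation_on_squares g = (\<chi> x y. of_bool (x \<in> squares \<and> x = g * y))"

subsection \<open>Distance spheres and stabilizer orbits\<close>

context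
  fixes m :: nat
  assumes card_eq: "CARD('f::{field,finite}) = 2 * m + 1" and even: "even m" and m_ge_2: "m \<ge> 2"
begin

text \<open>Parity of \<open>m\<close> serves this purpose: it makes the adjacency relation
  symmetric.\<close>

lemma minus_one_in_squares: "(-1::'f) \<in> squares"
  using even by (simp add: squares_eq_half_power[OF card_eq])

lemma minus_in_squares_iff: "- x \<in> squares \<longleftrightarrow> (x::'f) \<in> squares"
  using mult_squares_iff(1)[OF card_eq minus_one_in_squares, of x] by simp

lemma diff_in_squares_commute: "(x::'f) - y \<in> squares \<longleftrightarrow> y - x \<in> squares"
  using minus_in_squares_iff[of "x - y"] by simp

lemma obtain_nonsquare: obtains n :: 'f where "n \<in> nonsquares"
  using card_nonsquares[OF card_eq] m_ge_2 by (metis card.empty ex_in_conv not_numeral_le_zero)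

text \<open>Scaling by squares would spread one failure to all pairs. Then all squares would have
  the same, empty, set of neighbours among the nonsquares, contradicting separation. The result puts
  the nonsquares at distance two from \<open>0\<close>.\<close>

lemma nonsquare_has_square_neighbour:
  fixes z :: 'f
  assumes z: "z \<in> nonsquares"
  obtains s where "s \<in> squares" "z - s \<in> squares"
proof -
  have "\<exists>s\<in>squares. z - s \<in> squares"
  proof (rule ccontr)
    assume none: "\<not> (\<exists>s\<in>squares. z - s \<in> squares)"
    have no_edge: "s - w \<notin> squares" if s: "s \<in> squares" and w: "w \<in> nonsquares" for s w :: 'f
    proof
      assume "s - w \<in> squares"
      have u: "z / w \<in> squares" by (rule squares_divide(4)[OF card_eq z w])
      then have "z / w * (w - s) \<in> squares"
        using \<open>s - w \<in> squares\<close> diff_in_squares_commute squares_mult(1)[OF card_eq] by blast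
      moreover have "z / w * (w - s) = z - z / w * s"
        using w zero_notin_squares(2) by (cases "w = 0") (auto simp: field_simps)
      ultimately show False using none squares_mult(1)[OF card_eq u s] by auto
    qed
    have "\<not> squares \<subseteq> {1::'f}"
      using card_squares[OF card_eq] m_ge_2 card_mono[of "{1::'f}" squares] by auto
    then obtain x :: 'f where "x \<in> squares" "x \<noteq> 1" by blast
    then show False
      using squares_separated_by_nonsquares[OF card_eq _ one_in_squares minus_one_in_squares] no_edge
        one_in_squares by blast
  qed
  then show thesis using that by blast
qed

lemma graph_dist_paley:
  shows "graph_dist paley 0 (0::'f) = 0"
    and "x \<in> squares \<Longrightarrow> graph_dist paley 0 (x::'f) = 1"
    and "x \<in> nonsquares \<Longrightarrow> graph_dist paley 0 (x::'f) = 2"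
proof -
  have one: "((paley :: 'f graph) ^^ 1) 0 x \<longleftrightarrow> x \<in> squares" for x
    by (simp add: relpowp_1 paley_iff_squares minus_in_squares_iff del: One_nat_def)
  show "graph_dist paley 0 (0::'f) = 0"
    unfolding graph_dist_def by (rule Least_equality) auto
  show "graph_dist paley 0 x = 1" if x: "x \<in> squares" for x :: 'f
    unfolding graph_dist_def
  proof (rule Least_equality)
    show "((paley :: 'f graph) ^^ 1) 0 x" using one x by blast
    fix k assume "((paley :: 'f graph) ^^ k) 0 x"
    then show "1 \<le> k" using x by (cases k) auto
  qed
  show "graph_dist paley 0 x = 2" if x: "x \<in> nonsquares" for x :: 'f
    unfolding graph_dist_def
  proof (rule Least_equality)
    obtain s where s: "s \<in> squares" "x - s \<in> squares"
      using nonsquare_has_square_neighbour[OF x] .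
    have "((paley :: 'f graph) ^^ Suc 1) 0 x"
      using one[of s] s by (intro relpowp_Suc_I) (auto simp: paley_iff_squares diff_in_squares_commute[of s])
    then show "((paley :: 'f graph) ^^ 2) 0 x" by (simp add: numeral_2_eq_2)
    fix k assume k: "((paley :: 'f graph) ^^ k) 0 x"
    have "k \<noteq> 0" using k x by (cases k) auto
    moreover have "k \<noteq> 1" using k x one squares_nonsquares_disjoint by blast
    ultimately show "2 \<le> k" by simp
  qed
qed

lemma sphere_at_paley:
  "sphere_at paley (0::'f) 0 = {0}"
  "sphere_at paley (0::'f) 1 = squares"
  "sphere_at paley (0::'f) 2 = nonsquares"
proof -
  have "graph_dist paley 0 x = (if x = 0 then 0 else if x \<in> squares then 1 else 2)" for x :: 'f
    by (cases x rule: vertex_cases) (auto simp: graph_dist_paley dest: squares_nonsquares_disjoint)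
  then show "sphere_at paley (0::'f) 0 = {0}" "sphere_at paley (0::'f) 1 = squares"
    "sphere_at paley (0::'f) 2 = nonsquares"
    by (auto simp: sphere_at_def squares_def nonsquares_def split: if_splits)
qed

lemma eccentricity_paley: "eccentricity paley (0::'f) = 2"
  unfolding eccentricity_def
proof (rule Max_eqI)
  obtain n :: 'f where "n \<in> nonsquares" using obtain_nonsquare .
  then show "2 \<in> range (graph_dist paley (0::'f))"
    by (metis graph_dist_paley(3) rangeI)
  fix k assume "k \<in> range (graph_dist paley (0::'f))"
  then obtain x :: 'f where "k = graph_dist paley 0 x" by blast
  then show "k \<le> 2" by (cases x rule: vertex_cases) (auto simp: graph_dist_paley)
qed simp

lemma mult_square_in_vertex_stabilizer:
  fixes a :: 'f
  assumes a: "a \<in> squares"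
  shows "(\<lambda>x. a * x) \<in> vertex_stabilizer paley 0"
proof -
  have "a \<noteq> 0" using a by auto
  then have "bij (\<lambda>x. a * x)"
    by (intro bij_betw_byWitness[where f' = "\<lambda>x. x / a"]) auto
  then show ?thesis
    using mult_squares_iff(1)[OF card_eq a]
    by (simp add: vertex_stabilizer_def graph_automorphisms_def paley_iff_squares
        flip: right_diff_distrib)
qed

lemma vertex_stabilizer_preserves_classes:
  fixes x :: 'f
  assumes "\<sigma> \<in> vertex_stabilizer paley 0"
  shows "\<sigma> x = 0 \<longleftrightarrow> x = 0" "\<sigma> x \<in> squares \<longleftrightarrow> x \<in> squares" "\<sigma> x \<in> nonsquares \<longleftrightarrow> x \<in> nonsquares"
proof -
  have bij: "bij \<sigma>" and p: "\<And>x y. paley (\<sigma> x) (\<sigma> y) \<longleftrightarrow> paley x y" and zero: "\<sigma> 0 = 0"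
    using assms by (auto simp: vertex_stabilizer_def graph_automorphisms_def)
  show 0: "\<sigma> x = 0 \<longleftrightarrow> x = 0"
    using bij zero by (metis bij_pointE)
  show 1: "\<sigma> x \<in> squares \<longleftrightarrow> x \<in> squares"
    using p[of x 0] zero by (simp add: paley_iff_squares)
  show "\<sigma> x \<in> nonsquares \<longleftrightarrow> x \<in> nonsquares"
    using 0 1 by (auto simp: squares_def nonsquares_def)
qed

text \<open>Multiplication by \<open>y / x\<close> carries \<open>x\<close> to any \<open>y\<close>
  of its class, and adjacency to the fixed vertex \<open>0\<close> keeps the classes apart.\<close>

lemma vertex_stabilizer_orbit:
  fixes x :: 'f
  shows "(\<lambda>\<sigma>. \<sigma> 0) ` vertex_stabilizer paley (0::'f) = {0}"
    and "x \<in> squares \<Longrightarrow> (\<lambda>\<sigma>. \<sigma> x) ` vertex_stabilizer paley 0 = squares"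
    and "x \<in> nonsquares \<Longrightarrow> (\<lambda>\<sigma>. \<sigma> x) ` vertex_stabilizer paley 0 = nonsquares"
proof -
  have reach: "y \<in> (\<lambda>\<sigma>. \<sigma> x) ` vertex_stabilizer paley 0" if "y / x \<in> squares" for x y :: 'f
    using mult_square_in_vertex_stabilizer[OF that] that
    by (intro image_eqI[of _ _ "\<lambda>z. y / x * z"]) auto
  have "0 \<in> (\<lambda>\<sigma>. \<sigma> 0) ` vertex_stabilizer paley (0::'f)"
    using mult_square_in_vertex_stabilizer[OF one_in_squares] by (intro image_eqI) auto
  then show "(\<lambda>\<sigma>. \<sigma> 0) ` vertex_stabilizer paley (0::'f) = {0}"
    by (auto simp: vertex_stabilizer_def)
  show "(\<lambda>\<sigma>. \<sigma> x) ` vertex_stabilizer paley 0 = squares" if x: "x \<in> squares"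
    using vertex_stabilizer_preserves_classes(2)[of _ x] reach[OF squares_divide(1)[OF card_eq _ x]] x
    by auto
  show "(\<lambda>\<sigma>. \<sigma> x) ` vertex_stabilizer paley 0 = nonsquares" if x: "x \<in> nonsquares"
    using vertex_stabilizer_preserves_classes(3)[of _ x] reach[OF squares_divide(4)[OF card_eq _ x]] x
    by auto
qed

lemma stabilizer_orbits_paley:
  "stabilizer_orbits paley (0::'f) = {{0}, squares, nonsquares}"
proof
  show "stabilizer_orbits paley (0::'f) \<subseteq> {{0}, squares, nonsquares}"
    unfolding stabilizer_orbits_def
  proof (rule image_subsetI)
    fix x :: 'f
    show "(\<lambda>\<sigma>. \<sigma> x) ` vertex_stabilizer paley 0 \<in> {{0}, squares, nonsquares}"
      using vertex_stabilizer_orbit by (cases x rule: vertex_cases) auto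
  qed
  obtain n :: 'f where "n \<in> nonsquares" using obtain_nonsquare .
  then show "{{0}, squares, nonsquares} \<subseteq> stabilizer_orbits paley (0::'f)"
    unfolding stabilizer_orbits_def
    using rangeI[of "\<lambda>x. (\<lambda>\<sigma>. \<sigma> x) ` vertex_stabilizer paley (0::'f)" 0]
      rangeI[of "\<lambda>x. (\<lambda>\<sigma>. \<sigma> x) ` vertex_stabilizer paley (0::'f)" 1]
      rangeI[of "\<lambda>x. (\<lambda>\<sigma>. \<sigma> x) ` vertex_stabilizer paley (0::'f)" n]
    by (simp only: vertex_stabilizer_orbit one_in_squares insert_subset empty_subsetI simp_thms)
qed

lemma T2_paley_eq:
  "T2_algebra paley (0::'f) = generated_algebra
     {adjacency_matrix paley, diag_indicator {0}, diag_indicator squares, diag_indicator nonsquares}"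
proof -
  have "{..2::nat} = {0, 1, 2}" by auto
  then show ?thesis
    by (simp add: T2_algebra_def eccentricity_paley sphere_at_paley del: One_nat_def)
qed

lemma T3_paley_eq:
  "T3_algebra paley (0::'f) = generated_algebra
     {adjacency_matrix paley, diag_indicator {0}, diag_indicator squares, diag_indicator nonsquares}"
  by (simp add: T3_algebra_def stabilizer_orbits_paley)

subsection \<open>The strict inclusion of the first algebra in the second\<close>

text \<open>The partition into classes is equitable: the column sums \<open>D\<close> of the
  adjacency matrix over a set invariant under scaling by squares are constant on each class. The row
  of \<open>0\<close> is the indicator of the squares.\<close>

lemma adjacency_preserves_balanced:
  fixes v :: "(complex, 'f) vec"
  assumes v: "v \<in> balanced"
  shows "adjacency_matrix paley *v v \<in> balanced"
proof -
  let ?A = "adjacency_matrix (paley :: 'f graph)"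
  have class_sum: "(\<Sum>x\<in>C. (?A *v v) $ x) = 0"
    if C: "\<And>u x. u \<in> squares \<Longrightarrow> u * x \<in> C \<longleftrightarrow> x \<in> C" for C
  proof -
    define D where "D z = (\<Sum>x\<in>C. ?A $ x $ z)" for z
    have D: "D (u * z) = D z" if u: "u \<in> squares" for u z
    proof -
      have "u \<noteq> 0" using u by auto
      moreover have "x / u - z \<in> squares \<longleftrightarrow> x - u * z \<in> squares" for x
        using mult_squares_iff(1)[OF card_eq u, of "x / u - z"] \<open>u \<noteq> 0\<close>
        by (simp add: right_diff_distrib)
      moreover have "x / u \<in> C \<longleftrightarrow> x \<in> C" for x
        using C[OF u, of "x / u"] \<open>u \<noteq> 0\<close> by simp
      ultimately show ?thesis
        unfolding D_def
        by (intro sum.reindex_bij_witness[of _ "\<lambda>x. u * x" "\<lambda>x. x / u"])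
           (auto simp: C[OF u] adjacency_matrix_paley)
    qed
    have D_sq: "D z = D 1" if "z \<in> squares" for z using D[OF that, of 1] by simp
    obtain n :: 'f where n: "n \<in> nonsquares" using obtain_nonsquare .
    have D_nsq: "D z = D n" if "z \<in> nonsquares" for z
      using D[OF squares_divide(4)[OF card_eq that n], of n] n by (cases "n = 0") auto
    have "(\<Sum>x\<in>C. (?A *v v) $ x) = (\<Sum>z\<in>UNIV. D z * v $ z)"
      unfolding matrix_vector_mult_def D_def by (simp add: sum_distrib_right) (rule sum.swap)
    also have "\<dots> = D 0 * v $ 0 + ((\<Sum>z\<in>squares. D 1 * v $ z) + (\<Sum>z\<in>nonsquares. D n * v $ z))"
      unfolding sum_field_classes[of "\<lambda>z. D z * v $ z"]
      by (intro arg_cong2[where f = "(+)"] sum.cong refl) (simp_all add: D_sq D_nsq)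
    also have "\<dots> = 0"
      using v unfolding balanced_def by (simp flip: sum_distrib_left)
    finally show ?thesis .
  qed
  have "(?A *v v) $ 0 = (\<Sum>z\<in>UNIV. (if z \<in> squares then 1 else 0) * v $ z)"
    by (simp add: matrix_vector_mult_def adjacency_matrix_paley minus_in_squares_iff)
  also have "\<dots> = (\<Sum>z\<in>squares. v $ z)"
    unfolding sum_field_classes by (simp add: squares_nonsquares_disjoint)
  also have "\<dots> = 0" using v by (simp add: balanced_def)
  finally have "(?A *v v) $ 0 = 0" .
  then show ?thesis
    using class_sum mult_squares_iff[OF card_eq] by (simp add: balanced_def)
qed

text \<open>On the balanced vectors \<open>E\<^bsub>{0}\<^esub>\<close> is zero, so every element of \<open>T\<^sub>1\<close> commutes with
  \<open>A\<close> there.\<close>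

lemma diag_indicator_squares_notin_T1:
  "diag_indicator squares \<notin> T1_algebra paley (0::'f)"
proof
  let ?A = "adjacency_matrix (paley :: 'f graph)"
  let ?E = "diag_indicator (squares :: 'f set)"
  let ?F = "{M. \<forall>v\<in>balanced. M *v v \<in> balanced \<and> M *v (?A *v v) = ?A *v (M *v v)}"
  assume "?E \<in> T1_algebra paley 0"
  moreover have "T1_algebra paley 0 \<subseteq> ?F"
    unfolding T1_algebra_def
  proof (rule generated_algebra_minimal)
    show "unital_subalgebra ?F"
      by (rule unital_subalgebra_commuting_on_invariant)
         (auto simp: balanced_def sum.distrib simp flip: sum_distrib_left)
    have zero: "diag_indicator {0} *v v = 0" if "v \<in> balanced" for v :: "(complex, 'f) vec"
      using that by (auto simp: vec_eq_iff diag_indicator_mult_nth balanced_def)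
    have "0 \<in> balanced" by (simp add: balanced_def)
    then show "{?A, diag_indicator {0}} \<subseteq> ?F"
      using adjacency_preserves_balanced zero by auto
  qed
  ultimately have comm: "?E *v (?A *v v) = ?A *v (?E *v v)" if "v \<in> balanced" for v
    using that by blast
  have "x = 1" if x: "x \<in> squares" for x :: 'f
  proof (rule squares_separated_by_nonsquares[OF card_eq x one_in_squares minus_one_in_squares])
    fix z :: 'f assume z: "z \<in> nonsquares"
    \<comment> \<open>The difference of the unit vectors at the vertices \<open>x\<close> and
      \<open>1\<close>. It is supported on the squares, so commutation forces its image under
      \<open>?A\<close> to vanish on the nonsquares: \<open>x\<close> and \<open>1\<close> have the
      same neighbours there.\<close>
    define v :: "(complex, 'f) vec" where "v = axis x 1 - axis 1 1"
    have v: "v \<in> balanced"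
      using x one_in_squares squares_nonsquares_disjoint
      by (auto simp: balanced_def v_def sum_subtractf axis_def)
    have "?E *v v = v"
      using x one_in_squares by (auto simp: vec_eq_iff diag_indicator_mult_nth v_def axis_def)
    then have "(?A *v v) $ z = 0"
      using comm[OF v] z by (metis diag_indicator_mult_nth(3) squares_nonsquares_disjoint(2))
    moreover have "(?A *v v) $ z = ?A $ z $ x - ?A $ z $ 1"
      by (simp add: v_def matrix_vector_mult_diff_distrib matrix_vector_mul_component)
         (simp add: matrix_vector_mult_def axis_def if_distrib cong: if_cong)
    ultimately show "x - z \<in> squares \<longleftrightarrow> 1 - z \<in> squares"
      unfolding adjacency_matrix_paley diff_in_squares_commute[of _ z]
      by (auto simp: diff_in_squares_commute[of z] split: if_splits)
  qed
  then have "squares \<subseteq> {1::'f}" by blast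
  then show False
    using card_squares[OF card_eq] m_ge_2 card_mono[of "{1::'f}" squares] by auto
qed

subsection \<open>The strict inclusion of the third algebra in the fourth\<close>

lemma twist_row_sum:
  fixes g :: "'f \<Rightarrow> complex"
  shows "(\<Sum>z\<in>UNIV. twist n $ 0 $ z * g z) = of_nat (card {z \<in> squares. z - n \<in> squares}) * g 0"
    and "x \<in> squares \<Longrightarrow>
      (\<Sum>z\<in>UNIV. twist n $ x $ z * g z) = (\<Sum>z\<in>squares. of_bool (x * z - n \<in> squares) * g z)"
    and "x \<in> nonsquares \<Longrightarrow>
      (\<Sum>z\<in>UNIV. twist n $ x $ z * g z) = (\<Sum>z\<in>nonsquares. of_bool (1 - x * z / n \<in> squares) * g z)"
proof -
  show "(\<Sum>z\<in>UNIV. twist n $ 0 $ z * g z) = of_nat (card {z \<in> squares. z - n \<in> squares}) * g 0"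
  proof -
    have "twist n $ 0 $ z = 0" if "z \<in> squares \<or> z \<in> nonsquares" for z
      using that by (cases "z = 0") (simp_all add: twist_def)
    then have "(\<Sum>z\<in>squares. twist n $ 0 $ z * g z) = 0" "(\<Sum>z\<in>nonsquares. twist n $ 0 $ z * g z) = 0"
      by (auto intro!: sum.neutral)
    then show ?thesis unfolding sum_field_classes by (simp add: twist_def)
  qed
  show "(\<Sum>z\<in>UNIV. twist n $ x $ z * g z) = (\<Sum>z\<in>squares. of_bool (x * z - n \<in> squares) * g z)"
    if x: "x \<in> squares"
  proof -
    have "x \<noteq> 0" "x \<notin> nonsquares" using x squares_nonsquares_disjoint by auto
    then have "twist n $ x $ 0 = 0" "(\<Sum>z\<in>nonsquares. twist n $ x $ z * g z) = 0"
      by (auto simp: twist_def dest: squares_nonsquares_disjoint intro!: sum.neutral)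
    moreover have "(\<Sum>z\<in>squares. twist n $ x $ z * g z) = (\<Sum>z\<in>squares. of_bool (x * z - n \<in> squares) * g z)"
      using x \<open>x \<noteq> 0\<close> by (intro sum.cong refl) (simp add: twist_def)
    ultimately show ?thesis unfolding sum_field_classes by simp
  qed
  show "(\<Sum>z\<in>UNIV. twist n $ x $ z * g z) = (\<Sum>z\<in>nonsquares. of_bool (1 - x * z / n \<in> squares) * g z)"
    if x: "x \<in> nonsquares"
  proof -
    have "x \<noteq> 0" "x \<notin> squares" using x squares_nonsquares_disjoint by auto
    then have "twist n $ x $ 0 = 0" "(\<Sum>z\<in>squares. twist n $ x $ z * g z) = 0"
      by (auto simp: twist_def dest: squares_nonsquares_disjoint intro!: sum.neutral)
    moreover have "(\<Sum>z\<in>nonsquares. twist n $ x $ z * g z) = (\<Sum>z\<in>nonsquares. of_bool (1 - x * z / n \<in> squares) * g z)"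
      using x \<open>x \<noteq> 0\<close> \<open>x \<notin> squares\<close> by (intro sum.cong refl) (simp add: twist_def)
    ultimately show ?thesis unfolding sum_field_classes by simp
  qed
qed

text \<open>Both matrices are symmetric, so they commute as soon as their product \<open>B\<close>
  is symmetric, which is checked class by class.\<close>

lemma twist_commutes_with_adjacency:
  assumes n: "n \<in> nonsquares"
  shows "adjacency_matrix paley ** twist n = twist n ** adjacency_matrix (paley :: 'f graph)"
proof -
  define B where "B x y = (\<Sum>z\<in>UNIV. twist n $ x $ z * of_bool (z - y \<in> squares))" for x y
  note sq = squares_mult[OF card_eq] squares_divide[OF card_eq]
  have n0: "n \<noteq> 0" using n by auto
  have B_zero: "B y 0 = B 0 y" for y
  proof (cases y rule: vertex_cases)
    case 2
    then have "y \<noteq> 0" by auto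
    \<comment> \<open>All rows of the squares block have the same sum; the entry of
      \<open>twist n\<close> at \<open>(0, 0)\<close> is chosen to equal it.\<close>
    have "B y 0 = (\<Sum>z\<in>squares. of_bool (y * z - n \<in> squares))"
      unfolding B_def twist_row_sum(2)[OF 2] by (rule sum.cong) auto
    also have "\<dots> = (\<Sum>z\<in>squares. of_bool (z - n \<in> squares))"
      by (rule sum.reindex_bij_witness[of _ "\<lambda>z. z / y" "\<lambda>z. y * z"])
         (use 2 \<open>y \<noteq> 0\<close> in \<open>auto intro: sq\<close>)
    also have "\<dots> = of_nat (card {z \<in> squares. z - n \<in> squares})"
      by (simp add: of_bool_def flip: sum.inter_filter)
    also have "\<dots> = B 0 y"
      using 2 diff_in_squares_commute[of 0 y] by (simp add: B_def twist_row_sum)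
    finally show ?thesis .
  next
    case 3
    then have "y \<notin> squares" by (rule squares_nonsquares_disjoint)
    then have "B 0 y = 0"
      using diff_in_squares_commute[of 0 y] by (simp add: B_def twist_row_sum)
    moreover have "B y 0 = 0"
      unfolding B_def twist_row_sum(3)[OF 3]
      by (rule sum.neutral) (auto dest: squares_nonsquares_disjoint)
    ultimately show ?thesis by simp
  qed simp
  \<comment> \<open>The substitution \<open>n / z\<close> exchanges squares and nonsquares and
    matches the two blocks of \<open>twist n\<close>.\<close>
  have B_mixed: "B x y = B y x" if x: "x \<in> squares" and y: "y \<in> nonsquares" for x y
  proof -
    have "(\<Sum>z\<in>squares. of_bool (x * z - n \<in> squares) * of_bool (z - y \<in> squares))
      = (\<Sum>z\<in>nonsquares. of_bool (1 - y * z / n \<in> squares) * of_bool (z - x \<in> squares) :: complex)"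
    proof (rule sum.reindex_bij_witness[of _ "\<lambda>z. n / z" "\<lambda>z. n / z"])
      fix z :: 'f assume z: "z \<in> squares"
      then have z0: "z \<noteq> 0" by auto
      have "x * z - n = z * (x - n / z)" "z - y = z * (1 - y * (n / z) / n)"
        using z0 n0 by (auto simp: field_simps)
      then show "of_bool (1 - y * (n / z) / n \<in> squares) * of_bool (n / z - x \<in> squares)
        = (of_bool (x * z - n \<in> squares) * of_bool (z - y \<in> squares) :: complex)"
        using mult_squares_iff(1)[OF card_eq z] diff_in_squares_commute[of x "n / z"] by simp
      show "n / (n / z) = z" using z0 n0 by simp
      show "n / z \<in> nonsquares" using n z by (rule sq)
    next
      fix z :: 'f assume z: "z \<in> nonsquares"
      then have z0: "z \<noteq> 0" by auto
      show "n / (n / z) = z" using z0 n0 by simp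
      show "n / z \<in> squares" using n z by (rule sq)
    qed
    then show ?thesis unfolding B_def twist_row_sum(2)[OF x] twist_row_sum(3)[OF y] .
  qed
  \<comment> \<open>Replacing \<open>z\<close> by \<open>x / y * z\<close> exchanges the roles of
    \<open>x\<close> and \<open>y\<close>. The same works for two nonsquares, whose quotient is
    again a square.\<close>
  have B_squares: "B x y = B y x" if x: "x \<in> squares" and y: "y \<in> squares" for x y
  proof -
    have xy0: "x \<noteq> 0" "y \<noteq> 0" using x y by auto
    have "(\<Sum>z\<in>squares. of_bool (x * z - n \<in> squares) * of_bool (z - y \<in> squares))
      = (\<Sum>z\<in>squares. of_bool (y * z - n \<in> squares) * of_bool (z - x \<in> squares) :: complex)"
    proof (rule sum.reindex_bij_witness[of _ "\<lambda>z. y / x * z" "\<lambda>z. x / y * z"])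
      fix z :: 'f
      have "y * (x / y * z) = x * z" "x / y * z - x = x / y * (z - y)"
        using xy0 by (auto simp: field_simps)
      then show "of_bool (y * (x / y * z) - n \<in> squares) * of_bool (x / y * z - x \<in> squares)
        = (of_bool (x * z - n \<in> squares) * of_bool (z - y \<in> squares) :: complex)"
        using mult_squares_iff(1)[OF card_eq sq(5)[OF x y]] by simp
    qed (use x y xy0 in \<open>auto intro: sq\<close>)
    then show ?thesis unfolding B_def twist_row_sum(2)[OF x] twist_row_sum(2)[OF y] .
  qed
  have B_nonsquares: "B x y = B y x" if x: "x \<in> nonsquares" and y: "y \<in> nonsquares" for x y
  proof -
    have xy0: "x \<noteq> 0" "y \<noteq> 0" using x y by auto
    have "(\<Sum>z\<in>nonsquares. of_bool (1 - x * z / n \<in> squares) * of_bool (z - y \<in> squares))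
      = (\<Sum>z\<in>nonsquares. of_bool (1 - y * z / n \<in> squares) * of_bool (z - x \<in> squares) :: complex)"
    proof (rule sum.reindex_bij_witness[of _ "\<lambda>z. y / x * z" "\<lambda>z. x / y * z"])
      fix z :: 'f
      have "y * (x / y * z) = x * z" "x / y * z - x = x / y * (z - y)"
        using xy0 by (auto simp: field_simps)
      then show "of_bool (1 - y * (x / y * z) / n \<in> squares) * of_bool (x / y * z - x \<in> squares)
        = (of_bool (1 - x * z / n \<in> squares) * of_bool (z - y \<in> squares) :: complex)"
        using mult_squares_iff(1)[OF card_eq sq(8)[OF x y]] by simp
    qed (use x y xy0 in \<open>auto intro: sq\<close>)
    then show ?thesis unfolding B_def twist_row_sum(3)[OF x] twist_row_sum(3)[OF y] .
  qed
  have B_sym: "B x y = B y x" for x y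
    by (cases x rule: vertex_cases; cases y rule: vertex_cases)
       (metis B_zero B_mixed B_squares B_nonsquares)+
  have twist_sym: "twist n $ x $ y = twist n $ y $ x" for x y
    by (simp add: twist_def mult.commute conj_commute)
  have "(adjacency_matrix paley ** twist n) $ x $ y = (twist n ** adjacency_matrix paley) $ x $ y" for x y
  proof -
    have "(adjacency_matrix paley ** twist n) $ x $ y = B y x"
      unfolding B_def matrix_matrix_mult_def vec_lambda_beta adjacency_matrix_paley
      by (intro sum.cong refl) (simp add: twist_sym[of y] diff_in_squares_commute[of x] of_bool_def)
    also have "\<dots> = B x y" by (rule B_sym)
    also have "\<dots> = (twist n ** adjacency_matrix paley) $ x $ y"
      by (simp add: B_def matrix_matrix_mult_def adjacency_matrix_paley of_bool_def)
    finally show ?thesis .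
  qed
  then show ?thesis by (simp add: vec_eq_iff)
qed

lemma T3_paley_commutes_with_twist:
  fixes n :: 'f
  assumes "n \<in> nonsquares" "M \<in> T3_algebra paley 0"
  shows "M ** twist n = twist n ** M"
proof -
  have "diag_indicator Y ** twist n = twist n ** diag_indicator Y"
    if "\<And>x y. twist n $ x $ y \<noteq> 0 \<Longrightarrow> x \<in> Y \<longleftrightarrow> y \<in> Y" for Y
    using that by (auto simp: vec_eq_iff diag_indicator_mult_nth)
  moreover have "(x = 0 \<longleftrightarrow> y = 0) \<and> (x \<in> squares \<longleftrightarrow> y \<in> squares) \<and> (x \<in> nonsquares \<longleftrightarrow> y \<in> nonsquares)"
    if "twist n $ x $ y \<noteq> 0" for x y
    using that by (auto simp: twist_def split: if_splits dest: squares_nonsquares_disjoint)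
  ultimately have "{adjacency_matrix paley, diag_indicator {0}, diag_indicator squares, diag_indicator nonsquares}
      \<subseteq> {M. M ** twist n = twist n ** M}"
    using twist_commutes_with_adjacency[OF assms(1)] by auto
  then have "T3_algebra paley 0 \<subseteq> {M. M ** twist n = twist n ** M}"
    unfolding T3_paley_eq
    by (rule generated_algebra_minimal) (rule unital_subalgebra_centralizer)
  then show ?thesis using assms(2) by blast
qed

text \<open>Commuting with \<open>twist n\<close>, read at the entry \<open>(g, y)\<close>, says
  that \<open>y\<close> and \<open>g ^ 2 * y\<close> are both adjacent to \<open>n\<close> or both
  not. Division by \<open>y\<close> turns this into equal neighbours of \<open>1\<close> and
  \<open>g ^ 2\<close> among the nonsquares.\<close>

lemma dilation_notin_T3:
  fixes g :: 'f
  assumes g: "g \<in> squares" and g2: "g ^ 2 \<noteq> 1"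
  shows "dilation_on_squares g \<notin> T3_algebra paley 0"
proof
  assume T3: "dilation_on_squares g \<in> T3_algebra paley 0"
  have g0: "g \<noteq> 0" using g by auto
  obtain n :: 'f where n: "n \<in> nonsquares" using obtain_nonsquare .
  have n0: "n \<noteq> 0" using n by auto
  note comm = T3_paley_commutes_with_twist[OF n T3]
  have left: "(dilation_on_squares g ** twist n) $ x $ y = twist n $ (x / g) $ y"
    if x: "x \<in> squares" for x y
  proof -
    have "x = g * z \<longleftrightarrow> z = x / g" for z using g0 by (auto simp: field_simps)
    then show ?thesis
      using x by (simp add: matrix_matrix_mult_def dilation_on_squares_def of_bool_def if_distrib[of "\<lambda>u. u * _"] cong: if_cong)
  qed
  have right: "(twist n ** dilation_on_squares g) $ x $ y = twist n $ x $ (g * y)"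
    if y: "y \<in> squares" for x y
  proof -
    have "z \<in> squares \<and> z = g * y \<longleftrightarrow> z = g * y" for z
      using squares_mult(1)[OF card_eq g y] by auto
    then show ?thesis
      by (simp add: matrix_matrix_mult_def dilation_on_squares_def of_bool_def if_distrib cong: if_cong)
  qed
  have twist_squares: "twist n $ x $ y = (if x * y - n \<in> squares then 1 else 0)"
    if "x \<in> squares" "y \<in> squares" for x y
    using that by (cases "x = 0") (simp_all add: twist_def)
  have "g ^ 2 = 1"
  proof (rule squares_separated_by_nonsquares[OF card_eq power2_in_squares[OF g0] one_in_squares
        minus_one_in_squares])
    fix z :: 'f assume z: "z \<in> nonsquares"
    have z0: "z \<noteq> 0" using z by auto
    \<comment> \<open>As \<open>z\<close> runs through the nonsquares, \<open>n / z\<close> runs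
      through the squares.\<close>
    define y where "y = n / z"
    have y: "y \<in> squares" unfolding y_def using n z by (rule squares_divide[OF card_eq])
    have gy: "g * y \<in> squares" using g y by (rule squares_mult[OF card_eq])
    have "twist n $ 1 $ y = twist n $ g $ (g * y)"
      using comm left[OF g, of y] right[OF y, of g] g0 by simp
    then have "y - n \<in> squares \<longleftrightarrow> g * (g * y) - n \<in> squares"
      using twist_squares[OF one_in_squares y] twist_squares[OF g gy] by (auto split: if_splits)
    moreover have "y - n = y * (1 - z)" "g * (g * y) - n = y * (g ^ 2 - z)"
      using z0 by (auto simp: y_def field_simps power2_eq_square)
    ultimately show "g ^ 2 - z \<in> squares \<longleftrightarrow> 1 - z \<in> squares"
      using mult_squares_iff(1)[OF card_eq y] by simp
  qed
  then show False using g2 by simp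
qed

section \<open>Invariance under the stabilizer, and its elements over a prime field\<close>

lemma T3_paley_subset_T4: "T3_algebra paley (0::'f) \<subseteq> T4_algebra paley 0"
  unfolding T3_paley_eq
proof (rule generated_algebra_minimal)
  have "diag_indicator Y \<in> T4_algebra paley (0::'f)"
    if "\<And>\<sigma> x. \<sigma> \<in> vertex_stabilizer paley 0 \<Longrightarrow> \<sigma> x \<in> Y \<longleftrightarrow> x \<in> Y" for Y
    using that
    by (auto simp: T4_algebra_def diag_indicator_def vertex_stabilizer_def graph_automorphisms_def
        bij_def inj_eq)
  moreover have "adjacency_matrix paley \<in> T4_algebra paley (0::'f)"
    by (auto simp: T4_algebra_def adjacency_matrix_def vertex_stabilizer_def graph_automorphisms_def)
  ultimately show "{adjacency_matrix paley, diag_indicator {0}, diag_indicator squares, diag_indicator nonsquares}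
      \<subseteq> T4_algebra paley (0::'f)"
    using vertex_stabilizer_preserves_classes by auto
qed (rule unital_subalgebra_T4)

lemma vertex_stabilizer_paley_prime:
  assumes prime: "prime (CARD('f))" and \<sigma>: "\<sigma> \<in> vertex_stabilizer paley (0::'f)"
  obtains a where "a \<in> squares" "\<And>x. \<sigma> x = a * x"
proof -
  have "bij \<sigma>" "\<And>x y. \<sigma> x - \<sigma> y \<in> squares \<longleftrightarrow> x - y \<in> squares" "\<sigma> 0 = 0"
    using \<sigma> by (auto simp: vertex_stabilizer_def graph_automorphisms_def paley_iff_squares)
  then obtain a where a: "\<And>x. \<sigma> x = a * x"
    using square_difference_preserving_imp_linear[OF card_eq _ prime, of \<sigma>] m_ge_2
    by (auto simp: bij_def)
  have "\<sigma> 1 \<in> squares"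
    using vertex_stabilizer_preserves_classes(2)[OF \<sigma>] one_in_squares by blast
  then show thesis using a that by simp
qed

lemma dilation_in_T4:
  fixes g :: 'f
  assumes "prime (CARD('f))"
  shows "dilation_on_squares g \<in> T4_algebra paley 0"
proof -
  have "\<sigma> x \<in> squares \<and> \<sigma> x = g * \<sigma> y \<longleftrightarrow> x \<in> squares \<and> x = g * y"
    if \<sigma>: "\<sigma> \<in> vertex_stabilizer paley 0" for \<sigma> x y
  proof -
    obtain a where a: "a \<in> squares" "\<And>x. \<sigma> x = a * x"
      using vertex_stabilizer_paley_prime[OF assms \<sigma>] by blast
    then have "a \<noteq> 0" by auto
    then have "a * x = g * (a * y) \<longleftrightarrow> x = g * y" by (auto simp: mult.left_commute)
    then show ?thesis using a mult_squares_iff(1)[OF card_eq a(1)] by simp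
  qed
  then show ?thesis by (simp add: T4_algebra_def dilation_on_squares_def)
qed

end

theorem corollary8p6:
  fixes p :: nat
  assumes "prime p" and "p \<ge> 7" and "[p = 1] (mod 4)"
    and "CARD('f::{field,finite}) = p"
  shows "T1_algebra (paley :: 'f graph) 0 \<subset> T2_algebra (paley :: 'f graph) 0
       \<and> T2_algebra (paley :: 'f graph) 0 = T3_algebra (paley :: 'f graph) 0
       \<and> T3_algebra (paley :: 'f graph) 0 \<subset> T4_algebra (paley :: 'f graph) 0"
proof -
  \<comment> \<open>This is \<open>(p - 1) / 2\<close>, written so that it is visibly even.\<close>
  define m where "m = 2 * (p div 4)"
  have card_eq: "CARD('f) = 2 * m + 1"
    using assms(3,4) mult_div_mod_eq[of 4 p] by (simp add: m_def cong_def)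
  have even: "even m" by (simp add: m_def)
  have m: "m \<ge> 3" using assms(2,4) card_eq by simp
  then have m2: "m \<ge> 2" by simp
  note hyps = card_eq even m2
  \<comment> \<open>Three or more squares cannot all have square \<open>1\<close>; in the field of
    five elements they do, which is why \<open>p \<ge> 7\<close> is assumed.\<close>
  have "\<not> squares \<subseteq> {1, -1::'f}"
  proof
    assume "squares \<subseteq> {1, -1::'f}"
    then have "m \<le> card {1, -1::'f}" using card_mono[of "{1, -1::'f}" squares] card_squares[OF card_eq] by simp
    also have "\<dots> \<le> 2" by (simp add: card_insert_if)
    finally show False using m by simp
  qed
  then obtain g :: 'f where g: "g \<in> squares" "g ^ 2 \<noteq> 1"
    unfolding power2_eq_1_iff by blast
  have "T1_algebra (paley :: 'f graph) 0 \<subseteq> T2_algebra paley 0"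
    unfolding T1_algebra_def T2_paley_eq[OF hyps] by (rule generated_algebra_mono) auto
  moreover have "diag_indicator squares \<in> T2_algebra (paley :: 'f graph) 0"
    unfolding T2_paley_eq[OF hyps] by (rule subsetD[OF generated_algebra_superset]) simp
  moreover have "T2_algebra (paley :: 'f graph) 0 = T3_algebra paley 0"
    by (simp add: T2_paley_eq[OF hyps] T3_paley_eq[OF hyps])
  moreover have "dilation_on_squares g \<in> T4_algebra (paley :: 'f graph) 0"
    using assms(1,4) by (intro dilation_in_T4[OF hyps]) simp
  ultimately show ?thesis
    using diag_indicator_squares_notin_T1[OF hyps] dilation_notin_T3[OF hyps g] T3_paley_subset_T4[OF hyps]
    by blast
qed

end
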